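(* Let $n$ be odd and let $B$ be a string of length $n$ over $\{\mathrm{H},\mathrm{T}\}$ all of whose characters are the same. Then Alice cannot force a loss for herself against Bob's string $B$: there is no string $A\neq B$ of length $n$ such that Bob wins the No-Flippancy game with Alice's string $A$ and Bob's string $B$.
   Context: No-Flippancy game: Alice and Bob have distinct strings $A=A_1\cdots A_n$ and $B=B_1\cdots B_n$ of the same length $n$ over the alphabet $\{\mathrm{H},\mathrm{T}\}$. Starting from the empty sequence, the players alternate turns, Alice going first, and on each turn the current player appends one letter to the sequence (the game output) as follows: let $i<n$ be the maximal length of a suffix of the current sequence that coincides with a prefix of the current player's string ($i=0$ is allowed, via the empty suffix); the player appends the letter with index $i+1$ of their own string. The game ends as soon as $A$ or $B$ appears as a block of consecutive letters in the sequence (necessarily as its suffix, no matter who made the last move); the player whose string appears first wins and the other loses. If neither string ever appears, the game is infinite (nobody wins). *)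

theory Defs
  imports Main "HOL-Library.Sublist"
begin

datatype coin = H | T

definition overlap :: "coin list \<Rightarrow> coin list \<Rightarrow> nat" where
  "overlap P s = Max {i \<in> {..<length P}. suffix (take i P) s}"

(* Lists are indexed from 0, so the letter with index i + 1 in a string P is P ! i. *)
definition move :: "coin list \<Rightarrow> coin list \<Rightarrow> coin list" where
  "move P s = s @ [P ! overlap P s]"

definition finished :: "coin list \<Rightarrow> coin list \<Rightarrow> coin list \<Rightarrow> bool" where
  "finished A B s \<longleftrightarrow> sublist A s \<or> sublist B s"

(* The sequence after k turns (Alice's turns are those with an even number of turns before
   them); it stays constant once the game has ended. *)
fun game_seq :: "coin list \<Rightarrow> coin list \<Rightarrow> nat \<Rightarrow> coin list" where
  "game_seq A B 0 = []"
| "game_seq A B (Suc k) =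
     (let s = game_seq A B k in
      if finished A B s then s
      else if even k then move A s
      else move B s)"

definition bob_wins :: "coin list \<Rightarrow> coin list \<Rightarrow> bool" where
  "bob_wins A B \<longleftrightarrow>
     (\<exists>k. sublist B (game_seq A B k) \<and> (\<forall>j\<le>k. \<not> sublist A (game_seq A B j)))"

end

theory Submission
  imports Defs
begin

text \<open>
  Say B consists of the letter c only, so Bob always plays c, and let q be the length of the initial
  run of c in A. After q or q + 1 letters c, whichever number is even, Alice plays a d other than c; as n
  is odd, this happens within the first n turns, so Bob does not win with the opening run, and
  Alice wins at once if q = n - 1. Otherwise, if Bob wins, the final run of n letters c is preceded
  by a d, which is a move of Alice, so Alice also makes the move after the first n - 2 letters of
  that run. There her overlap is either at most n - 2, hence equal to q, and she plays d, or it is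
  n - 1, and she completes A.
\<close>

lemma overlap_candidate:
  assumes "P \<noteq> []"
  shows "overlap P s \<in> {i \<in> {..<length P}. suffix (take i P) s}"
  unfolding overlap_def
proof (rule Max_in)
  have "0 \<in> {i \<in> {..<length P}. suffix (take i P) s}"
    using assms by simp
  then show "{i \<in> {..<length P}. suffix (take i P) s} \<noteq> {}"
    by blast
qed simp

lemma overlap_less: "P \<noteq> [] \<Longrightarrow> overlap P s < length P"
  using overlap_candidate[of P s] by simp

lemma suffix_overlap: "P \<noteq> [] \<Longrightarrow> suffix (take (overlap P s) P) s"
  using overlap_candidate[of P s] by simp

lemma overlap_ge: "i < length P \<Longrightarrow> suffix (take i P) s \<Longrightarrow> i \<le> overlap P s"
  unfolding overlap_def by (rule Max_ge) auto

lemma suffix_replicate: "suffix (replicate m x) (replicate r x)" if "m \<le> r"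
proof -
  have "replicate r x = replicate (r - m) x @ replicate m x"
    using that by (simp flip: replicate_add)
  then show ?thesis
    by (metis suffixI)
qed

text \<open>A matching prefix of \<open>A\<close> longer than \<open>q\<close> contains
  \<open>d\<close>, so it cannot lie inside a run of \<open>c\<close>. The bound
  \<open>overlap A s \<le> r\<close> keeps the match inside the run; a longer match could reach past
  the start of the run.\<close>

lemma overlap_run:
  assumes A: "A = replicate q c @ d # R" and "d \<noteq> c"
    and run: "suffix (replicate r c) s" and le: "overlap A s \<le> r"
  shows "overlap A s = min q r"
proof (rule antisym)
  let ?i = "overlap A s"
  have ne: "A \<noteq> []" and len: "q < length A"
    using A by auto
  have less: "?i < length A"
    using overlap_less[OF ne] .
  have "suffix (take ?i A) (replicate r c)"
    using suffix_length_suffix[OF suffix_overlap[OF ne] run] le less by simp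
  then have all: "x = c" if "x \<in> set (take ?i A)" for x
    using that set_mono_suffix by fastforce
  have "?i \<le> q"
  proof (rule ccontr)
    assume "\<not> ?i \<le> q"
    then have "take ?i A ! q \<in> set (take ?i A)"
      using less by (intro nth_mem) simp
    moreover have "take ?i A ! q = d"
      using \<open>\<not> ?i \<le> q\<close> A by (simp add: nth_append)
    ultimately show False
      using all \<open>d \<noteq> c\<close> by metis
  qed
  then show "?i \<le> min q r"
    using le by simp
  have "take (min q r) A = replicate (min q r) c"
    using A by (simp add: min_def)
  then have "suffix (take (min q r) A) s"
    using suffix_replicate[of "min q r" r c] run suffix_order.trans by fastforce
  then show "min q r \<le> ?i"
    using len by (intro overlap_ge) auto
qed

lemma overlap_replicate:
  assumes "A = replicate q c @ d # R" and "d \<noteq> c"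
  shows "overlap A (replicate r c) = min q r"
proof (rule overlap_run[OF assms])
  have ne: "A \<noteq> []"
    using assms by simp
  show "overlap A (replicate r c) \<le> r"
    using suffix_length_le[OF suffix_overlap[OF ne, of "replicate r c"]]
      overlap_less[OF ne, of "replicate r c"] by simp
qed simp

text \<open>Bob's overlap does not matter: it is a valid index of his string, and each letter there
  is \<open>c\<close>.\<close>

lemma game_seq_Suc:
  assumes "n > 0" and "\<not> finished A (replicate n c) (game_seq A (replicate n c) j)"
  shows "game_seq A (replicate n c) (Suc j) = game_seq A (replicate n c) j
    @ [if even j then A ! overlap A (game_seq A (replicate n c) j) else c]"
  using assms overlap_less[of "replicate n c" "game_seq A (replicate n c) j"]
  by (simp add: Let_def move_def)

text \<open>Each turn of an unfinished game appends exactly one letter, so earlier positions and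
  single moves can be read off the final sequence.\<close>

lemma take_game_seq:
  assumes "n > 0"
    and "\<forall>j<k. \<not> finished A (replicate n c) (game_seq A (replicate n c) j)"
    and "j \<le> k"
  shows "take j (game_seq A (replicate n c) k) = game_seq A (replicate n c) j
    \<and> length (game_seq A (replicate n c) k) = k"
  using assms(2,3)
proof (induction k arbitrary: j)
  case (Suc k)
  have step: "game_seq A (replicate n c) (Suc k) = game_seq A (replicate n c) k
    @ [if even k then A ! overlap A (game_seq A (replicate n c) k) else c]"
    using game_seq_Suc[OF assms(1)] Suc.prems by blast
  have IH: "take i (game_seq A (replicate n c) k) = game_seq A (replicate n c) i
    \<and> length (game_seq A (replicate n c) k) = k" if "i \<le> k" for i
    using Suc.IH[of i] Suc.prems that by simp
  show ?case
  proof (cases "j = Suc k")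
    case True
    then show ?thesis
      using step IH[of k] by simp
  next
    case False
    then show ?thesis
      using step IH[of j] Suc.prems by (simp del: game_seq.simps)
  qed
qed simp

text \<open>On a run of \<open>j < q\<close> letters \<open>c\<close> Alice's overlap is
  \<open>j\<close>, so she too plays \<open>c\<close>. If \<open>q\<close> is odd, the turn after
  \<open>q\<close> letters is Bob's, which prolongs the run by one.\<close>

lemma opening_run:
  assumes A: "A = replicate q c @ d # R" and "d \<noteq> c" and "n > 0"
    and unf: "\<forall>j<k. \<not> finished A (replicate n c) (game_seq A (replicate n c) j)"
    and "j \<le> k" and "j \<le> q \<or> odd q \<and> j = Suc q"
  shows "game_seq A (replicate n c) j = replicate j c"
  using assms(5,6)
proof (induction j)
  case (Suc j)
  then have IH: "game_seq A (replicate n c) j = replicate j c"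
    by auto
  have "(if even j then A ! overlap A (replicate j c) else c) = c"
    using Suc.prems A overlap_replicate[OF A \<open>d \<noteq> c\<close>, of j] by (auto simp: nth_append)
  moreover have "\<not> finished A (replicate n c) (game_seq A (replicate n c) j)"
    using unf Suc.prems by simp
  ultimately have "game_seq A (replicate n c) (Suc j) = replicate j c @ [c]"
    using game_seq_Suc[OF \<open>n > 0\<close>, of A c j] unfolding IH
    by (simp del: game_seq.simps split del: if_split)
  then show ?case
    by (simp add: replicate_append_same del: game_seq.simps)
qed simp

lemma not_bob_wins_constant:
  assumes "odd n" and lenA: "length A = n" and neq: "A \<noteq> replicate n c"
  shows "\<not> bob_wins A (replicate n c)"
proof
  assume "bob_wins A (replicate n c)"
  let ?g = "game_seq A (replicate n c)"
  have n: "n > 0"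
    using \<open>odd n\<close> by (rule odd_pos)
  obtain k0 where k0: "sublist (replicate n c) (?g k0)" "\<forall>j\<le>k0. \<not> sublist A (?g j)"
    using \<open>bob_wins A (replicate n c)\<close> unfolding bob_wins_def by blast
  \<comment> \<open>The first time Bob's string appears. It is at most \<open>k0\<close>, so
    \<open>A\<close> is absent up to \<open>k\<close> and the game really runs for \<open>k\<close>
    turns.\<close>
  define k where "k = (LEAST k. sublist (replicate n c) (?g k))"
  have win: "sublist (replicate n c) (?g k)"
    using k0(1) unfolding k_def by (rule LeastI)
  have first: "\<not> sublist (replicate n c) (?g j)" if "j < k" for j
    using that unfolding k_def by (rule not_less_Least)
  have "k \<le> k0"
    using k0(1) unfolding k_def by (rule Least_le)
  then have noA: "\<not> sublist A (?g j)" if "j \<le> k" for j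
    using k0(2) that by simp
  have unf: "\<forall>j<k. \<not> finished A (replicate n c) (?g j)"
    using first noA by (simp add: finished_def)
  have step: "?g (Suc j) = ?g j @ [if even j then A ! overlap A (?g j) else c]" if "j < k" for j
    using game_seq_Suc[OF n] unf that by blast
  have takeg: "take j (?g k) = ?g j" if "j \<le> k" for j
    using take_game_seq[OF n unf that] by simp
  have leng: "length (?g k) = k"
    using take_game_seq[OF n unf order_refl] by simp
  have nk: "n \<le> k"
    using sublist_length_le[OF win] leng by simp
  then obtain k' where k': "k = Suc k'"
    using n by (cases k) auto
  have "suffix (replicate n c) (?g k)"
    using win first[of k'] step[of k'] k' sublist_snoc by (metis lessI)
  then obtain u where u: "?g k = u @ replicate n c"
    by (auto simp: suffix_def)
  have lenu: "length u + n = k"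
    using u leng by simp
  obtain q d R where A: "A = replicate q c @ d # R" and "d \<noteq> c"
  proof -
    have "\<exists>x\<in>set A. x \<noteq> c"
      using neq lenA replicate_eqI by metis
    then obtain ys d R where "A = ys @ d # R" "d \<noteq> c" "\<forall>y\<in>set ys. \<not> y \<noteq> c"
      by (rule split_list_first_propE)
    then show thesis
      using that[of "length ys" d R] replicate_eqI[of ys "length ys" c] by metis
  qed
  have Aq: "A ! q = d" and "q < n" and A_ne: "A \<noteq> []"
    using A lenA by (auto simp: nth_append)
  \<comment> \<open>Alice's first turn after at least \<open>q\<close> letters \<open>c\<close>: her
    overlap there is \<open>q\<close>, so she plays \<open>d\<close>.\<close>
  define j0 where "j0 = (if even q then q else Suc q)"
  have "even j0" "q \<le> j0"
    by (auto simp: j0_def)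
  \<comment> \<open>Parity of \<open>n\<close> enters here: if \<open>q = n - 1\<close>, then
    \<open>q\<close> is even and \<open>j0 = q\<close>.\<close>
  have "j0 < n"
    using \<open>q < n\<close> \<open>odd n\<close> by (auto simp: j0_def) presburger
  have g0: "?g j0 = replicate j0 c"
    using opening_run[OF A \<open>d \<noteq> c\<close> n unf, of j0] \<open>j0 < n\<close> nk by (auto simp: j0_def)
  then have g1: "?g (Suc j0) = replicate j0 c @ [d]"
    using step[of j0] \<open>j0 < n\<close> nk \<open>even j0\<close> \<open>q \<le> j0\<close> overlap_replicate[OF A \<open>d \<noteq> c\<close>, of j0] Aq
    by (simp del: game_seq.simps)
  have "Suc q < n"
  proof (rule ccontr)
    assume "\<not> Suc q < n"
    then have "Suc q = n"
      using \<open>q < n\<close> by simp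
    then have "A = replicate q c @ [d]" "j0 = q"
      using A lenA \<open>j0 < n\<close> \<open>q \<le> j0\<close> by auto
    then show False
      using noA[of "Suc j0"] g1 \<open>j0 < n\<close> nk by auto
  qed
  have "u \<noteq> []"
  proof
    assume "u = []"
    then have "?g (Suc j0) = replicate (Suc j0) c"
      using takeg[of "Suc j0"] u lenu \<open>j0 < n\<close> by (simp add: min_def del: game_seq.simps replicate.simps)
    then show False
      using g1 \<open>d \<noteq> c\<close> by (simp flip: replicate_append_same del: game_seq.simps)
  qed
  then obtain v e where v: "u = v @ [e]"
    by (metis rev_exhaust)
  \<comment> \<open>Otherwise a run of \<open>n\<close> letters \<open>c\<close> would already be
    complete one turn earlier, against the choice of \<open>k\<close>.\<close>
  have "e \<noteq> c"
  proof
    assume "e = c"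
    obtain n' where n': "n = Suc n'"
      using n by (cases n) auto
    have "?g k = (v @ c # replicate n' c) @ [c]"
      using u v \<open>e = c\<close> n' by (simp add: replicate_append_same del: game_seq.simps)
    moreover have "k' = length (v @ c # replicate n' c)"
      using lenu v n' k' by simp
    moreover have "take k' (?g k) = ?g k'"
      using takeg[of k'] k' by simp
    ultimately have "?g k' = v @ c # replicate n' c"
      by (metis append_eq_conv_conj)
    then have "sublist (replicate n c) (?g k')"
      using n' by (simp add: sublist_append del: game_seq.simps)
    then show False
      using first[of k'] k' by simp
  qed
  have letter: "?g k ! j = (if even j then A ! overlap A (?g j) else c)" if "j < k" for j
  proof -
    have "?g k ! j = take (Suc j) (?g k) ! j"
      by simp
    also have "\<dots> = ?g (Suc j) ! j"
      using takeg[of "Suc j"] that by simp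
    moreover have "length (?g j) = j"
      using takeg[of j] leng that by (metis length_take min.absorb2 nat_less_le order_refl)
    ultimately show ?thesis
      using step[OF that] by (simp add: nth_append)
  qed
  have "?g k ! length v = e"
    using u v by simp
  \<comment> \<open>Only Alice can have played a letter other than \<open>c\<close>. As
    \<open>k = length v + 1 + n\<close> with \<open>n\<close> odd, \<open>k\<close> is even as
    well.\<close>
  then have "even (length v)"
    using letter[of "length v"] \<open>e \<noteq> c\<close> lenu v n by (auto split: if_splits)
  then have "even k"
    using lenu v \<open>odd n\<close> by auto
  \<comment> \<open>The last turn of Alice before Bob's final move; the run after \<open>u\<close>
    then has \<open>n - 2\<close> letters and she has to extend it.\<close>
  define m where "m = k - 2"
  have k: "k = m + 2" and "2 \<le> n"
    using \<open>Suc q < n\<close> nk by (auto simp: m_def)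
  have "even m" "m < k"
    using k \<open>even k\<close> by auto
  have gm: "?g m = u @ replicate (n - 2) c"
  proof -
    have "m - length u = n - 2"
      using lenu k by simp
    then show ?thesis
      using takeg[of m] u lenu \<open>m < k\<close> k \<open>2 \<le> n\<close> by (simp add: min_def del: game_seq.simps)
  qed
  have "?g k ! m = c"
    using u lenu k \<open>2 \<le> n\<close> by (simp add: nth_append del: game_seq.simps)
  then have playc: "A ! overlap A (?g m) = c"
    using letter[OF \<open>m < k\<close>] \<open>even m\<close> by simp
  show False
  proof (cases "overlap A (?g m) \<le> n - 2")
    case True
    have "suffix (replicate (n - 2) c) (?g m)"
      using gm by (simp add: suffixI)
    \<comment> \<open>The minimum of \<open>q\<close> and \<open>n - 2\<close> is \<open>q\<close>
      because \<open>Suc q < n\<close>.\<close>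
    from overlap_run[OF A \<open>d \<noteq> c\<close> this True] have "overlap A (?g m) = q"
      using \<open>Suc q < n\<close> by simp
    then show False
      using playc Aq \<open>d \<noteq> c\<close> by simp
  next
    case False
    \<comment> \<open>Now all of \<open>A\<close> but its last letter is matched, so Alice's move
      completes \<open>A\<close> at turn \<open>Suc m < k\<close>, before Bob's string
      appears.\<close>
    define i where "i = overlap A (?g m)"
    have i: "Suc i = n"
      using False overlap_less[OF A_ne, of "?g m"] lenA by (simp add: i_def)
    have "suffix (take i A) (?g m)"
      using suffix_overlap[OF A_ne] by (simp add: i_def)
    then have "suffix (take i A @ [A ! i]) (?g m @ [A ! i])"
      by simp
    moreover have "take i A @ [A ! i] = A"
      using i lenA by (metis lessI order_refl take_Suc_conv_app_nth take_all)
    moreover have "?g (Suc m) = ?g m @ [A ! i]"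
      using step[OF \<open>m < k\<close>] \<open>even m\<close> by (simp add: i_def)
    ultimately have "sublist A (?g (Suc m))"
      by (metis suffix_imp_sublist)
    then show False
      using noA[of "Suc m"] k by simp
  qed
qed

theorem lemma9:
  fixes n :: nat and B :: "coin list"
  assumes "odd n"
    and "length B = n"
    and "\<exists>c. \<forall>x\<in>set B. x = c"
  shows "\<not> (\<exists>A. length A = n \<and> A \<noteq> B \<and> bob_wins A B)"
proof -
  obtain c where "B = replicate n c"
    using assms(2,3) replicate_eqI by metis
  then show ?thesis
    using not_bob_wins_constant[OF \<open>odd n\<close>] by blast
qed

end
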